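(* Consider the Group-R2 prior with $G$ groups of sizes $p_1,\dots,p_G$ and $\sigma^2=1$ as defined in the context, with $a_G>0$, $a_2>0$ and $c_g=a_G/p_g$. The marginal prior density of $b_{gl}$ for any $g=1,\dots,G$ and $l=1,\dots,p_g$ is $$p(b_{gl})=\frac{1}{\sqrt{2\pi}\,\mathrm{B}(c_g,a_2)}\,\Gamma(\eta)\,U(\eta,\nu_g,z_{gl}),$$ where $\eta=a_2+1/2$, $\nu_g=3/2-c_g$ and $z_{gl}=|b_{gl}|^2/2$. Alternatively, if the within-group concentration parameters $c_g$ are specified and $a_G$ is set as $a_G=\frac1G\sum_{g=1}^Gp_gc_g$, the same conclusion follows.
   Context: Group-R2 prior (with $\sigma^2=1$): $R^2\sim\mathrm{Beta}(Ga_G,a_2)$ and $\tau^2=R^2/(1-R^2)$; $\phi=(\phi_1,\dots,\phi_G)$ is symmetric Dirichlet with all concentration parameters equal to $a_G$; for each $g$, $\varphi_g=(\varphi_{g1},\dots,\varphi_{gp_g})$ is symmetric Dirichlet with all concentration parameters equal to $c_g$; the variables $\tau^2,\phi,\varphi_1,\dots,\varphi_G$ are mutually independent; and conditionally on them the coefficients $b_{gl}$ are independent with $b_{gl}\sim\mathrm{Normal}(0,\varphi_{gl}\phi_g\tau^2)$ (variance parametrization). The subscript in $a_G$ is only a label. $\mathrm{B}$ and $\Gamma$ are the Beta and Gamma functions. $U$ is the confluent hypergeometric function of the second kind; for $\eta>0$, $z>0$, $U(\eta,\nu,z)=\frac1{\Gamma(\eta)}\int_0^\infty e^{-zt}t^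{\eta-1}(1+t)^{\nu-\eta-1}\,dt$.
   Formalization: The "Alternatively" clause fails for arbitrary specified c_g (e.g. G=2, p=(1,1), c=(1,3)); it is stated for positive c_h with a_G their given mean and, for the group g considered, the added condition c_g = a_G/p_g, exactly the case where the formula holds. *)

theory Defs
  imports "HOL-Probability.Probability"
begin

definition beta_density :: "real \<Rightarrow> real \<Rightarrow> real \<Rightarrow> real" where
  "beta_density a b x =
     (if 0 < x \<and> x < 1 then x powr (a - 1) * (1 - x) powr (b - 1) / Beta a b else 0)"

text \<open>
  The Dirichlet distribution on the simplex of points with coordinates indexed by
  \<open>{1..n}\<close>, for \<open>n \<ge> 1\<close>.  Its density is taken with respect to Lebesgue measure on the
  first \<open>n - 1\<close> coordinates, the last coordinate being one minus their sum.  For \<open>n = 1\<close>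
  the space of free coordinates is a single point, and the distribution is the point mass
  at the vector whose only coordinate is 1.
\<close>

definition dirichlet_density :: "nat \<Rightarrow> (nat \<Rightarrow> real) \<Rightarrow> (nat \<Rightarrow> real) \<Rightarrow> real" where
  "dirichlet_density n \<alpha> y =
     (if \<forall>i\<in>{1..n}. 0 < y i
      then Gamma (\<Sum>i=1..n. \<alpha> i) / (\<Prod>i=1..n. Gamma (\<alpha> i)) * (\<Prod>i=1..n. y i powr (\<alpha> i - 1))
      else 0)"

definition simplex_point :: "nat \<Rightarrow> (nat \<Rightarrow> real) \<Rightarrow> (nat \<Rightarrow> real)" where
  "simplex_point n x = x(n := 1 - (\<Sum>i\<in>{1..<n}. x i))"

definition dirichlet :: "nat \<Rightarrow> (nat \<Rightarrow> real) \<Rightarrow> (nat \<Rightarrow> real) measure" where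
  "dirichlet n \<alpha> =
     distr
       (density (\<Pi>\<^sub>M i\<in>{1..<n}. lborel) (\<lambda>x. ennreal (dirichlet_density n \<alpha> (simplex_point n x))))
       (\<Pi>\<^sub>M i\<in>{1..n}. borel)
       (simplex_point n)"

text \<open>
  The normal distribution parametrized by its variance, whereas \<^const>\<open>normal_density\<close>
  takes the standard deviation.  The degenerate branch makes this a probability measure for
  every second argument; in the prior below the variance is positive almost surely.
\<close>

definition normal_var :: "real \<Rightarrow> real \<Rightarrow> real measure" where
  "normal_var m v =
     (if 0 < v then density lborel (\<lambda>x. ennreal (normal_density m (sqrt v) x))
      else return lborel m)"

text \<open>
  The joint law of \<open>(\<tau>\<^sup>2, \<phi>, (\<psi>\<^sub>1, \<dots>, \<psi>\<^sub>G))\<close>, where \<open>\<psi>\<^sub>g\<close> holds the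
  within-group proportions; mutual independence is expressed by taking the
  product measure.
\<close>

definition group_R2_hyper ::
  "nat \<Rightarrow> (nat \<Rightarrow> nat) \<Rightarrow> real \<Rightarrow> real \<Rightarrow> (nat \<Rightarrow> real)
     \<Rightarrow> (real \<times> (nat \<Rightarrow> real) \<times> (nat \<Rightarrow> nat \<Rightarrow> real)) measure" where
  "group_R2_hyper G p a\<^sub>G a\<^sub>2 c =
     distr (density lborel (\<lambda>r. ennreal (beta_density (real G * a\<^sub>G) a\<^sub>2 r))) borel (\<lambda>r. r / (1 - r))
     \<Otimes>\<^sub>M (dirichlet G (\<lambda>_. a\<^sub>G)
     \<Otimes>\<^sub>M (\<Pi>\<^sub>M g\<in>{1..G}. dirichlet (p g) (\<lambda>_. c g)))"

text \<open>
  The law of the coefficient vector, indexed by pairs of a group and a position in it: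
  given the hyperparameters, the coefficients are independent centred normals.
\<close>

definition group_R2_prior ::
  "nat \<Rightarrow> (nat \<Rightarrow> nat) \<Rightarrow> real \<Rightarrow> real \<Rightarrow> (nat \<Rightarrow> real) \<Rightarrow> (nat \<times> nat \<Rightarrow> real) measure" where
  "group_R2_prior G p a\<^sub>G a\<^sub>2 c =
     bind (group_R2_hyper G p a\<^sub>G a\<^sub>2 c)
       (\<lambda>(\<tau>2, \<phi>, \<psi>). \<Pi>\<^sub>M (g, l)\<in>(SIGMA g:{1..G}. {1..p g}). normal_var 0 (\<psi> g l * \<phi> g * \<tau>2))"

text \<open>
  The confluent hypergeometric function of the second kind, by its integral
  representation, for \<open>\<eta> > 0\<close> and \<open>z > 0\<close>.
\<close>

definition hyperU :: "real \<Rightarrow> real \<Rightarrow> real \<Rightarrow> real" where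
  "hyperU \<eta> \<nu> z =
     1 / Gamma \<eta> * (LBINT t:{0<..}. exp (- z * t) * t powr (\<eta> - 1) * (1 + t) powr (\<nu> - \<eta> - 1))"

end

theory Submission
  imports Defs
begin

text \<open>
  A Dirichlet vector multiplied by an independent Gamma variable whose shape is the
  total concentration has independent Gamma coordinates.  Writing the beta prime variable
  \<open>\<tau>\<^sup>2\<close> as a quotient \<open>S / W\<close> of independent Gamma variables with shapes \<open>G a\<^sub>G\<close> and \<open>a\<^sub>2\<close>,
  multiplication by \<open>\<phi>\<^sub>g\<close> replaces the shape of \<open>S\<close> by \<open>a\<^sub>G\<close>, and multiplication by
  \<open>\<psi>\<^sub>g\<^sub>l\<close> replaces \<open>a\<^sub>G = p\<^sub>g c\<^sub>g\<close> by \<open>c\<^sub>g\<close>.  So the variance of \<open>b\<^sub>g\<^sub>l\<close> is beta prime with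
  parameters \<open>c\<^sub>g\<close> and \<open>a\<^sub>2\<close>, and mixing the normal density over the precision is the
  integral that defines \<open>U\<close>.
\<close>

declare One_nat_def [simp del]

section \<open>Gamma laws of unit rate\<close>

text \<open>\<open>a\<close> is the shape. The rate is fixed at 1 because a common rate cancels in a
  quotient of Gamma variables. The value 0 at every \<open>y\<close> \<le> 0 lets sign arguments
  replace restrictions of the domain later on.\<close>

definition gamma_density :: "real \<Rightarrow> real \<Rightarrow> real" where
  "gamma_density a y = (if 0 < y then y powr (a - 1) * exp (- y) / Gamma a else 0)"

lemma gamma_density_measurable [measurable]: "gamma_density a \<in> borel_measurable borel"
  unfolding gamma_density_def by measurable

lemma gamma_density_nonneg: "0 < a \<Longrightarrow> 0 \<le> gamma_density a y"
  by (simp add: gamma_density_def)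

lemma nn_integral_gamma_density:
  assumes "0 < a"
  shows "(\<integral>\<^sup>+y. ennreal (gamma_density a y) \<partial>lborel) = 1"
proof -
  \<comment> \<open>Euler's integral is taken over the closed half-line, so the endpoint 0 is
    discarded as a null set.\<close>
  have "AE y in lborel. ennreal (gamma_density a y) =
      ennreal ((indicator {0..} y * y powr (a - 1) / exp y) / Gamma a)"
    using AE_lborel_singleton[of 0]
    by eventually_elim (auto simp: gamma_density_def indicator_def exp_minus field_simps)
  then have "(\<integral>\<^sup>+y. ennreal (gamma_density a y) \<partial>lborel) =
      (\<integral>\<^sup>+y. ennreal ((indicator {0..} y * y powr (a - 1) / exp y) / Gamma a) \<partial>lborel)"
    by (rule nn_integral_cong_AE)
  also have "\<dots> = (\<integral>\<^sup>+y. ennreal (indicator {0..} y * y powr (a - 1) / exp y) / ennreal (Gamma a) \<partial>lborel)"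
    using assms by (intro nn_integral_cong divide_ennreal[symmetric]) auto
  also have "\<dots> = ennreal (Gamma a) / ennreal (Gamma a)"
    using assms by (subst nn_integral_divide) (auto simp: Gamma_conv_nn_integral_real)
  also have "\<dots> = 1"
    using Gamma_real_pos[OF assms] by (simp add: divide_ennreal)
  finally show ?thesis .
qed

section \<open>Scaling of Lebesgue measure on finite products\<close>

interpretation lborel_prod: product_sigma_finite "\<lambda>_. lborel :: real measure" ..

text \<open>Supplies the Jacobian of the polar substitution below. Coordinates are peeled off one at
  a time, each contributing a factor \<open>s\<close> by the one-dimensional affine rule; the
  restricted lambda keeps the scaled point in the extensional product space.\<close>

lemma nn_integral_PiM_lborel_scale:
  fixes s :: real
  assumes "finite I" and s: "0 < s" and "f \<in> borel_measurable (\<Pi>\<^sub>M i\<in>I. lborel)"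
  shows "(\<integral>\<^sup>+x. f x \<partial>(\<Pi>\<^sub>M i\<in>I. lborel)) =
    ennreal (s ^ card I) * (\<integral>\<^sup>+x. f (\<lambda>i\<in>I. s * x i) \<partial>(\<Pi>\<^sub>M i\<in>I. lborel))"
  using assms(1,3)
proof (induction I arbitrary: f rule: finite_induct)
  case empty
  show ?case by (simp add: lborel_prod.nn_integral_empty restrict_def del: nn_integral_const)
next
  case (insert i I)
  note [measurable] = insert.prems
  have [simp]: "(\<lambda>j\<in>I. s * x j)(i := s * y) = (\<lambda>j\<in>insert i I. s * (x(i := y)) j)" for x y
    using insert.hyps by (auto simp: fun_eq_iff)
  have upd: "(\<lambda>y. f (x(i := y))) \<in> borel_measurable borel" if "x \<in> space (\<Pi>\<^sub>M i\<in>I. lborel)" for x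
    using measurable_comp[OF measurable_component_update insert.prems, OF that insert.hyps(2)]
    by (simp add: comp_def fun_upd_def)
  have "(\<lambda>x. f (\<lambda>j\<in>insert i I. s * x j)) \<in> borel_measurable (\<Pi>\<^sub>M i\<in>insert i I. lborel)"
    by measurable
  from measurable_compose[OF measurable_add_dim this]
  have inner: "(\<lambda>x. \<integral>\<^sup>+y. f (\<lambda>j\<in>insert i I. s * (x(i := y)) j) \<partial>lborel)
      \<in> borel_measurable (\<Pi>\<^sub>M i\<in>I. lborel)"
    by (intro lborel.borel_measurable_nn_integral) (simp add: case_prod_beta)
  have "(\<integral>\<^sup>+x. f x \<partial>(\<Pi>\<^sub>M i\<in>insert i I. lborel)) =
      (\<integral>\<^sup>+x. \<integral>\<^sup>+y. f (x(i := y)) \<partial>lborel \<partial>(\<Pi>\<^sub>M i\<in>I. lborel))"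
    using insert by (subst lborel_prod.product_nn_integral_insert) auto
  also have "\<dots> = (\<integral>\<^sup>+x. ennreal s * (\<integral>\<^sup>+y. f (x(i := s * y)) \<partial>lborel) \<partial>(\<Pi>\<^sub>M i\<in>I. lborel))"
    using s by (intro nn_integral_cong, subst nn_integral_real_affine[where c = s and t = 0])
      (auto intro: upd)
  also have "\<dots> = ennreal (s ^ card I) *
      (\<integral>\<^sup>+x. ennreal s * (\<integral>\<^sup>+y. f (\<lambda>j\<in>insert i I. s * (x(i := y)) j) \<partial>lborel) \<partial>(\<Pi>\<^sub>M i\<in>I. lborel))"
    by (subst insert.IH) simp_all
  also have "\<dots> = ennreal (s ^ card (insert i I)) *
      (\<integral>\<^sup>+x. \<integral>\<^sup>+y. f (\<lambda>j\<in>insert i I. s * (x(i := y)) j) \<partial>lborel \<partial>(\<Pi>\<^sub>M i\<in>I. lborel))"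
    using s insert.hyps
    by (subst nn_integral_cmult[OF inner]) (auto simp: mult.assoc[symmetric] ennreal_mult[symmetric] ac_simps)
  also have "(\<integral>\<^sup>+x. \<integral>\<^sup>+y. f (\<lambda>j\<in>insert i I. s * (x(i := y)) j) \<partial>lborel \<partial>(\<Pi>\<^sub>M i\<in>I. lborel)) =
      (\<integral>\<^sup>+x. f (\<lambda>j\<in>insert i I. s * x j) \<partial>(\<Pi>\<^sub>M i\<in>insert i I. lborel))"
    using insert.hyps by (subst lborel_prod.product_nn_integral_insert) auto
  finally show ?case .
qed

section \<open>Dirichlet laws as proportions of independent Gamma variables\<close>

lemma simplex_point_sum: "1 \<le> n \<Longrightarrow> (\<Sum>i=1..n. simplex_point n x i) = 1"
proof -
  assume "1 \<le> n"
  then have "{1..n} = insert n {1..<n}" by auto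
  then show ?thesis by (simp add: simplex_point_def)
qed

lemma simplex_point_measurable:
  assumes "1 \<le> n" and M: "\<And>i. sets (M i) = sets borel"
  shows "simplex_point n \<in> (\<Pi>\<^sub>M i\<in>{1..<n}. lborel) \<rightarrow>\<^sub>M PiM {1..n} M"
proof -
  have *: "{1..n} = insert n {1..<n}" using assms by auto
  have "simplex_point n \<in> (\<Pi>\<^sub>M i\<in>{1..<n}. lborel) \<rightarrow>\<^sub>M (\<Pi>\<^sub>M i\<in>insert n {1..<n}. borel)"
    unfolding simplex_point_def
    by (rule measurable_fun_upd[where J = "{1..<n}"]) auto
  then show ?thesis
    unfolding * by (subst measurable_cong_sets[OF refl, of _ "\<Pi>\<^sub>M i\<in>insert n {1..<n}. borel"])
      (auto intro!: sets_PiM_cong simp: M)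
qed

text \<open>Since the coordinates of \<open>y\<close> sum to 1, the exponentials multiply to
  \<open>exp (- s)\<close>. The powers of \<open>s\<close> collect to the total concentration minus
  \<open>n\<close>, and the Jacobian \<open>s ^ (n - 1)\<close> raises this to the exponent of a
  single Gamma density; what remains depends on \<open>y\<close> alone.\<close>

lemma gamma_dirichlet_factor:
  assumes n: "1 \<le> n" and pos: "\<And>i. i \<in> {1..n} \<Longrightarrow> 0 < \<alpha> i" and s: "0 < s"
    and one: "(\<Sum>i=1..n. y i) = 1"
  shows "s ^ (n - 1) * (\<Prod>i=1..n. gamma_density (\<alpha> i) (s * y i)) =
    gamma_density (\<Sum>i=1..n. \<alpha> i) s * dirichlet_density n \<alpha> y"
proof (cases "\<forall>i\<in>{1..n}. 0 < y i")
  case True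
  \<comment> \<open>This constant is the denominator of the Gamma density of \<open>s\<close> and
    the numerator of the Dirichlet density, so it has to cancel.\<close>
  have "Gamma (\<Sum>i=1..n. \<alpha> i) > 0"
    using n pos by (intro Gamma_real_pos sum_pos) auto
  have "(\<Prod>i=1..n. gamma_density (\<alpha> i) (s * y i)) =
      (\<Prod>i=1..n. s powr (\<alpha> i - 1) * exp (- (s * y i)) * (y i powr (\<alpha> i - 1) / Gamma (\<alpha> i)))"
    using True s by (intro prod.cong) (auto simp: gamma_density_def powr_mult)
  also have "\<dots> = s powr (\<Sum>i=1..n. \<alpha> i - 1) * exp (\<Sum>i=1..n. - (s * y i)) *
      ((\<Prod>i=1..n. y i powr (\<alpha> i - 1)) / (\<Prod>i=1..n. Gamma (\<alpha> i)))"
    using s by (simp add: prod.distrib prod_dividef powr_sum exp_sum)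
  also have "(\<Sum>i=1..n. - (s * y i)) = - s"
    using one by (simp add: sum_negf flip: sum_distrib_left)
  also have "(\<Sum>i=1..n. \<alpha> i - 1) = (\<Sum>i=1..n. \<alpha> i) - real n"
    by (simp add: sum_subtractf)
  finally have "s ^ (n - 1) * (\<Prod>i=1..n. gamma_density (\<alpha> i) (s * y i)) =
      (s powr real (n - 1) * s powr ((\<Sum>i=1..n. \<alpha> i) - real n)) * exp (- s) *
      ((\<Prod>i=1..n. y i powr (\<alpha> i - 1)) / (\<Prod>i=1..n. Gamma (\<alpha> i)))"
    using s by (simp add: powr_realpow)
  also have "s powr real (n - 1) * s powr ((\<Sum>i=1..n. \<alpha> i) - real n) = s powr ((\<Sum>i=1..n. \<alpha> i) - 1)"
    using n by (simp add: of_nat_diff flip: powr_add)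
  finally show ?thesis
    using True s \<open>Gamma _ > 0\<close> by (simp add: gamma_density_def dirichlet_density_def)
next
  case False
  then obtain i where "i \<in> {1..n}" "\<not> 0 < y i" by blast
  moreover from this s have "gamma_density (\<alpha> i) (s * y i) = 0"
    by (simp add: gamma_density_def zero_less_mult_iff)
  ultimately show ?thesis
    using False by (auto simp: dirichlet_density_def)
qed

lemma dirichlet_density_measurable:
  assumes "1 \<le> n"
  shows "(\<lambda>x. dirichlet_density n \<alpha> (simplex_point n x)) \<in> borel_measurable (\<Pi>\<^sub>M i\<in>{1..<n}. lborel)"
proof -
  have [measurable]: "simplex_point n \<in> (\<Pi>\<^sub>M i\<in>{1..<n}. lborel) \<rightarrow>\<^sub>M PiM {1..n} (\<lambda>_. borel)"
    using assms by (intro simplex_point_measurable) auto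
  have [measurable]: "(\<lambda>x. simplex_point n x i) \<in> borel_measurable (\<Pi>\<^sub>M i\<in>{1..<n}. lborel)"
    if "i \<in> {1..n}" for i
    using that by measurable
  show ?thesis
    unfolding dirichlet_density_def by measurable
qed

lemma dirichlet_density_nonneg:
  assumes "\<And>i. i \<in> {1..n} \<Longrightarrow> 0 < \<alpha> i"
  shows "0 \<le> dirichlet_density n \<alpha> y"
proof -
  have "0 \<le> Gamma (\<Sum>i=1..n. \<alpha> i)"
    \<comment> \<open>For \<open>n = 0\<close> the empty sum is 0, where \<open>Gamma\<close> has
      the default value 0.\<close>
    using assms by (cases "n = 0") (auto intro!: less_imp_le Gamma_real_pos sum_pos)
  then show ?thesis
    using assms by (auto simp: dirichlet_density_def intro!: mult_nonneg_nonneg divide_nonneg_nonneg prod_nonneg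
      less_imp_le[OF Gamma_real_pos])
qed

text \<open>Substituting \<open>s\<close> for the sum of the coordinates in place of the last one, and then scaling the
  others by \<open>s\<close>, separates the sum of independent Gamma variables from their proportions.\<close>

lemma nn_integral_gamma_conv_dirichlet:
  assumes n: "1 \<le> n" and pos: "\<And>i. i \<in> {1..n} \<Longrightarrow> 0 < \<alpha> i"
    and h [measurable]: "h \<in> borel_measurable (\<Pi>\<^sub>M i\<in>{1..n}. lborel)"
  shows "(\<integral>\<^sup>+y. h y * (\<Prod>i=1..n. ennreal (gamma_density (\<alpha> i) (y i))) \<partial>(\<Pi>\<^sub>M i\<in>{1..n}. lborel)) =
    (\<integral>\<^sup>+x. ennreal (dirichlet_density n \<alpha> (simplex_point n x)) *
       (\<integral>\<^sup>+s. ennreal (gamma_density (\<Sum>i=1..n. \<alpha> i) s) * h (\<lambda>i\<in>{1..n}. s * simplex_point n x i) \<partial>lborel)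
      \<partial>(\<Pi>\<^sub>M i\<in>{1..<n}. lborel))"
proof -
  let ?P = "\<Pi>\<^sub>M i\<in>{1..<n}. lborel :: real measure"
  let ?Q = "\<Pi>\<^sub>M i\<in>{1..n}. lborel :: real measure"
  let ?A = "\<Sum>i=1..n. \<alpha> i"
  define F where "F y = h y * (\<Prod>i=1..n. ennreal (gamma_density (\<alpha> i) (y i)))" for y
  \<comment> \<open>\<open>T x s\<close> completes \<open>x\<close> to a point whose coordinates sum
    to \<open>s\<close>.\<close>
  define T where "T = (\<lambda>x s. x(n := s - (\<Sum>i\<in>{1..<n}. x i)) :: nat \<Rightarrow> real)"
  have ins: "{1..n} = insert n {1..<n}" using n by auto
  have F[measurable]: "F \<in> borel_measurable ?Q" unfolding F_def by measurable
  interpret P: sigma_finite_measure ?P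
    using lborel_prod.sigma_finite[of "{1..<n}"] by simp
  interpret PL: pair_sigma_finite ?P lborel ..
  have T[measurable]: "(\<lambda>(x, s). T x s) \<in> ?P \<Otimes>\<^sub>M lborel \<rightarrow>\<^sub>M ?Q"
    unfolding T_def ins case_prod_beta by (rule measurable_fun_upd[where J = "{1..<n}"]) auto
  have R[measurable]: "(\<lambda>(x, s). \<lambda>i\<in>{1..n}. s * simplex_point n x i) \<in> ?P \<Otimes>\<^sub>M lborel \<rightarrow>\<^sub>M ?Q"
  proof -
    have "(\<lambda>z. simplex_point n (fst z) i) \<in> borel_measurable (?P \<Otimes>\<^sub>M (lborel :: real measure))"
      if "i \<in> {1..n}" for i
      using measurable_compose[OF measurable_fst simplex_point_measurable[OF n, of "\<lambda>_. borel"]]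
        measurable_compose[OF _ measurable_component_singleton[OF that]] by blast
    then show ?thesis unfolding case_prod_beta by (intro measurable_restrict) simp
  qed
  have upd: "(\<lambda>y. F (x(n := y))) \<in> borel_measurable borel" if "x \<in> space ?P" for x
    using measurable_comp[OF measurable_component_update F[unfolded ins], OF that]
    by (simp add: comp_def fun_upd_def)
  have zero: "F (T x s) = 0" if "s \<le> 0" for x s
  proof (rule ccontr)
    assume "F (T x s) \<noteq> 0"
    then have "ennreal (gamma_density (\<alpha> i) (T x s i)) \<noteq> 0" if "i \<in> {1..n}" for i
      using that by (auto simp: F_def)
    then have *: "0 < T x s i" if "i \<in> {1..n}" for i
      using that by (metis gamma_density_def ennreal_0)
    have "0 < (\<Sum>i=1..n. T x s i)" using * n by (intro sum_pos) auto
    also have "\<dots> = s" unfolding ins by (simp add: T_def)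
    finally show False using that by simp
  qed
  have polar: "ennreal (s ^ (n - 1)) * F (T (\<lambda>i\<in>{1..<n}. s * x i) s) =
      ennreal (dirichlet_density n \<alpha> (simplex_point n x)) *
        (ennreal (gamma_density ?A s) * h (\<lambda>i\<in>{1..n}. s * simplex_point n x i))"
    if s: "0 < s" and x: "x \<in> space ?P" for x s
  proof -
    have T_eq: "T (\<lambda>i\<in>{1..<n}. s * x i) s = (\<lambda>i\<in>{1..n}. s * simplex_point n x i)"
      using n by (auto simp: T_def simplex_point_def fun_eq_iff algebra_simps sum_distrib_left)
    have "ennreal (s ^ (n - 1)) * (\<Prod>i=1..n. ennreal (gamma_density (\<alpha> i) (s * simplex_point n x i))) =
        ennreal (s ^ (n - 1) * (\<Prod>i=1..n. gamma_density (\<alpha> i) (s * simplex_point n x i)))"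
      using s pos
      by (subst prod_ennreal) (auto intro!: ennreal_mult[symmetric] prod_nonneg gamma_density_nonneg)
    also have "\<dots> = ennreal (gamma_density ?A s * dirichlet_density n \<alpha> (simplex_point n x))"
      by (subst gamma_dirichlet_factor[OF n pos s simplex_point_sum[OF n]]) auto
    also have "\<dots> = ennreal (gamma_density ?A s) * ennreal (dirichlet_density n \<alpha> (simplex_point n x))"
      using n pos by (intro ennreal_mult gamma_density_nonneg dirichlet_density_nonneg sum_pos) auto
    finally have eq: "ennreal (s ^ (n - 1)) *
        (\<Prod>i=1..n. ennreal (gamma_density (\<alpha> i) (s * simplex_point n x i))) = \<dots>" .
    have "ennreal (s ^ (n - 1)) * F (T (\<lambda>i\<in>{1..<n}. s * x i) s) =
        h (\<lambda>i\<in>{1..n}. s * simplex_point n x i) * (ennreal (s ^ (n - 1)) *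
          (\<Prod>i=1..n. ennreal (gamma_density (\<alpha> i) (s * simplex_point n x i))))"
      unfolding T_eq F_def by (simp add: ac_simps)
    then show ?thesis
      unfolding eq by (simp add: ac_simps)
  qed
  have "(\<integral>\<^sup>+y. F y \<partial>?Q) = (\<integral>\<^sup>+x. \<integral>\<^sup>+y. F (x(n := y)) \<partial>lborel \<partial>?P)"
    unfolding ins by (rule lborel_prod.product_nn_integral_insert[OF _ _ F[unfolded ins]]) auto
  \<comment> \<open>The last coordinate is translated by the sum of the others, which has Jacobian
    1.\<close>
  also have "\<dots> = (\<integral>\<^sup>+x. \<integral>\<^sup>+s. F (T x s) \<partial>lborel \<partial>?P)"
  proof (rule nn_integral_cong)
    fix x assume x: "x \<in> space ?P"
    show "(\<integral>\<^sup>+y. F (x(n := y)) \<partial>lborel) = (\<integral>\<^sup>+s. F (T x s) \<partial>lborel)"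
      using nn_integral_real_affine[OF upd[OF x], where c = 1 and t = "- (\<Sum>i\<in>{1..<n}. x i)"]
      by (simp add: T_def)
  qed
  \<comment> \<open>With \<open>s\<close> outermost it is a constant by which the other coordinates
    can be scaled; a second exchange afterwards restores the order.\<close>
  also have "\<dots> = (\<integral>\<^sup>+s. \<integral>\<^sup>+x. F (T x s) \<partial>?P \<partial>lborel)"
    by (rule PL.Fubini'[symmetric]) measurable
  also have "\<dots> = (\<integral>\<^sup>+s. \<integral>\<^sup>+x. ennreal (dirichlet_density n \<alpha> (simplex_point n x)) *
      (ennreal (gamma_density ?A s) * h (\<lambda>i\<in>{1..n}. s * simplex_point n x i)) \<partial>?P \<partial>lborel)"
  proof (rule nn_integral_cong)
    fix s :: real
    have meas: "(\<lambda>x. F (T x s)) \<in> borel_measurable ?P" by measurable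
    show "(\<integral>\<^sup>+x. F (T x s) \<partial>?P) = (\<integral>\<^sup>+x. ennreal (dirichlet_density n \<alpha> (simplex_point n x)) *
      (ennreal (gamma_density ?A s) * h (\<lambda>i\<in>{1..n}. s * simplex_point n x i)) \<partial>?P)"
    proof (cases "0 < s")
      case True
      have m2: "(\<lambda>x. F (T (\<lambda>i\<in>{1..<n}. s * x i) s)) \<in> borel_measurable ?P"
        by (rule measurable_compose[OF _ meas]) simp
      have "(\<integral>\<^sup>+x. F (T x s) \<partial>?P) =
          ennreal (s ^ (n - 1)) * (\<integral>\<^sup>+x. F (T (\<lambda>i\<in>{1..<n}. s * x i) s) \<partial>?P)"
        using nn_integral_PiM_lborel_scale[OF _ True meas] by simp
      also have "\<dots> = (\<integral>\<^sup>+x. ennreal (s ^ (n - 1)) * F (T (\<lambda>i\<in>{1..<n}. s * x i) s) \<partial>?P)"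
        using m2 by (rule nn_integral_cmult[symmetric])
      also have "\<dots> = (\<integral>\<^sup>+x. ennreal (dirichlet_density n \<alpha> (simplex_point n x)) *
          (ennreal (gamma_density ?A s) * h (\<lambda>i\<in>{1..n}. s * simplex_point n x i)) \<partial>?P)"
        using True by (intro nn_integral_cong polar)
      finally show ?thesis .
    next
      case False
      then show ?thesis by (simp add: zero gamma_density_def)
    qed
  qed
  also have "\<dots> = (\<integral>\<^sup>+x. \<integral>\<^sup>+s. ennreal (dirichlet_density n \<alpha> (simplex_point n x)) *
      (ennreal (gamma_density ?A s) * h (\<lambda>i\<in>{1..n}. s * simplex_point n x i)) \<partial>lborel \<partial>?P)"
  proof (rule PL.Fubini')
    have [measurable]: "(\<lambda>x. dirichlet_density n \<alpha> (simplex_point n x)) \<in> borel_measurable ?P"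
      using n by (rule dirichlet_density_measurable)
    have [measurable]: "(\<lambda>z. h (\<lambda>i\<in>{1..n}. snd z * simplex_point n (fst z) i)) \<in> borel_measurable (?P \<Otimes>\<^sub>M lborel)"
      using measurable_compose[OF R h] by (simp add: case_prod_beta)
    show "(\<lambda>(x, s). ennreal (dirichlet_density n \<alpha> (simplex_point n x)) *
      (ennreal (gamma_density ?A s) * h (\<lambda>i\<in>{1..n}. s * simplex_point n x i)))
      \<in> borel_measurable (?P \<Otimes>\<^sub>M lborel)"
      unfolding case_prod_beta by measurable
  qed
  also have "\<dots> = (\<integral>\<^sup>+x. ennreal (dirichlet_density n \<alpha> (simplex_point n x)) *
       (\<integral>\<^sup>+s. ennreal (gamma_density ?A s) * h (\<lambda>i\<in>{1..n}. s * simplex_point n x i) \<partial>lborel) \<partial>?P)"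
  proof (intro nn_integral_cong nn_integral_cmult)
    fix x assume x: "x \<in> space ?P"
    have "(\<lambda>s. \<lambda>i\<in>{1..n}. s * simplex_point n x i) \<in> lborel \<rightarrow>\<^sub>M ?Q"
      using measurable_compose[OF measurable_Pair1'[OF x] R] by simp
    then show "(\<lambda>s. ennreal (gamma_density ?A s) * h (\<lambda>i\<in>{1..n}. s * simplex_point n x i))
       \<in> borel_measurable lborel"
      by measurable
  qed
  finally show ?thesis unfolding F_def .
qed

lemma sets_dirichlet [simp, measurable_cong]: "sets (dirichlet n \<alpha>) = sets (\<Pi>\<^sub>M i\<in>{1..n}. borel)"
  by (simp add: dirichlet_def)

lemma nn_integral_dirichlet:
  assumes n: "1 \<le> n" and [measurable]: "h \<in> borel_measurable (\<Pi>\<^sub>M i\<in>{1..n}. borel)"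
  shows "(\<integral>\<^sup>+y. h y \<partial>dirichlet n \<alpha>) =
    (\<integral>\<^sup>+x. ennreal (dirichlet_density n \<alpha> (simplex_point n x)) * h (simplex_point n x)
      \<partial>(\<Pi>\<^sub>M i\<in>{1..<n}. lborel))"
proof -
  have [measurable]: "simplex_point n \<in> (\<Pi>\<^sub>M i\<in>{1..<n}. lborel) \<rightarrow>\<^sub>M PiM {1..n} (\<lambda>_. borel)"
    using n by (intro simplex_point_measurable) auto
  have [measurable]: "(\<lambda>x. dirichlet_density n \<alpha> (simplex_point n x)) \<in> borel_measurable (\<Pi>\<^sub>M i\<in>{1..<n}. lborel)"
    using n by (rule dirichlet_density_measurable)
  show ?thesis
    unfolding dirichlet_def by (subst nn_integral_distr) (auto simp: nn_integral_density)
qed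

text \<open>The preceding identity read from right to left, with a test function of coordinate
  \<open>l\<close> only. On the Gamma side the integrand is then a product of one-variable
  functions, and all factors except the \<open>l\<close>-th integrate to 1.\<close>

lemma nn_integral_dirichlet_scaled:
  assumes pos: "\<And>i. i \<in> {1..n} \<Longrightarrow> 0 < \<alpha> i" and l: "l \<in> {1..n}"
    and [measurable]: "k \<in> borel_measurable borel"
  shows "(\<integral>\<^sup>+\<phi>. (\<integral>\<^sup>+s. ennreal (gamma_density (\<Sum>i=1..n. \<alpha> i) s) * k (\<phi> l * s) \<partial>lborel) \<partial>dirichlet n \<alpha>) =
    (\<integral>\<^sup>+s. ennreal (gamma_density (\<alpha> l) s) * k s \<partial>lborel)"
proof -
  have n: "1 \<le> n" using l by auto
  have [measurable]: "(\<lambda>y. y l) \<in> borel_measurable (\<Pi>\<^sub>M i\<in>{1..n}. borel :: real measure)"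
    "(\<lambda>y. y l) \<in> borel_measurable (\<Pi>\<^sub>M i\<in>{1..n}. lborel :: real measure)"
    using l by measurable
  let ?f = "\<lambda>i s. ennreal (gamma_density (\<alpha> i) s) * (if i = l then k s else 1)"
  have split: "k (y l) * (\<Prod>i=1..n. ennreal (gamma_density (\<alpha> i) (y i))) = (\<Prod>i=1..n. ?f i (y i))" for y
    using l by (simp add: prod.distrib prod.delta' prod.delta if_distrib[of k] ac_simps)
  have "(\<integral>\<^sup>+\<phi>. (\<integral>\<^sup>+s. ennreal (gamma_density (\<Sum>i=1..n. \<alpha> i) s) * k (\<phi> l * s) \<partial>lborel) \<partial>dirichlet n \<alpha>) =
      (\<integral>\<^sup>+y. k (y l) * (\<Prod>i=1..n. ennreal (gamma_density (\<alpha> i) (y i))) \<partial>(\<Pi>\<^sub>M i\<in>{1..n}. lborel))"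
    using n pos l
    by (subst nn_integral_dirichlet, simp, measurable, subst nn_integral_gamma_conv_dirichlet)
      (auto simp: ac_simps)
  also have "\<dots> = (\<Prod>i=1..n. \<integral>\<^sup>+s. ?f i s \<partial>lborel)"
    unfolding split by (subst lborel_prod.product_nn_integral_prod) auto
  also have "\<dots> = (\<Prod>i=1..n. if i = l then \<integral>\<^sup>+s. ennreal (gamma_density (\<alpha> l) s) * k s \<partial>lborel else 1)"
    using pos by (intro prod.cong) (auto simp: nn_integral_gamma_density)
  also have "\<dots> = (\<integral>\<^sup>+s. ennreal (gamma_density (\<alpha> l) s) * k s \<partial>lborel)"
    using l by (simp add: prod.delta)
  finally show ?thesis .
qed

text \<open>No simplex integral is computed: taking the constant 1 for \<open>k\<close> in the
  scaling identity reduces the total mass to those of Gamma densities.\<close>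

lemma prob_space_dirichlet:
  assumes n: "1 \<le> n" and pos: "\<And>i. i \<in> {1..n} \<Longrightarrow> 0 < \<alpha> i"
  shows "prob_space (dirichlet n \<alpha>)"
proof
  have "0 < (\<Sum>i=1..n. \<alpha> i)"
    using n pos by (intro sum_pos) auto
  then show "emeasure (dirichlet n \<alpha>) (space (dirichlet n \<alpha>)) = 1"
    using nn_integral_dirichlet_scaled[of n \<alpha> 1 "\<lambda>_. 1"] n pos
    by (simp add: nn_integral_gamma_density)
qed

section \<open>Beta prime laws as quotients of Gamma variables\<close>

text \<open>Written as the very pushforward that occurs in \<open>group_R2_hyper\<close>, so that
  folding the definition exposes it there.\<close>

definition beta_prime :: "real \<Rightarrow> real \<Rightarrow> real measure" where
  "beta_prime a b = distr (density lborel (\<lambda>r. ennreal (beta_density a b r))) borel (\<lambda>r. r / (1 - r))"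

lemma beta_density_measurable [measurable]: "beta_density a b \<in> borel_measurable borel"
  unfolding beta_density_def by measurable

lemma sets_beta_prime [simp, measurable_cong]: "sets (beta_prime a b) = sets borel"
  by (simp add: beta_prime_def)

text \<open>A Beta variable is the first coordinate of a two-dimensional Dirichlet vector, and the
  quotient of two Gamma variables depends only on their proportions. So this is the Gamma-Dirichlet
  identity for \<open>n = 2\<close>.\<close>

lemma nn_integral_beta_prime:
  assumes a: "0 < a" and b: "0 < b" and [measurable]: "k \<in> borel_measurable borel"
  shows "(\<integral>\<^sup>+v. k v \<partial>beta_prime a b) =
    (\<integral>\<^sup>+w. ennreal (gamma_density b w) * (\<integral>\<^sup>+s. ennreal (gamma_density a s) * k (s / w) \<partial>lborel) \<partial>lborel)"
proof -
  define \<alpha> where "\<alpha> i = (if i = 1 then a else b)" for i :: nat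
  have eqs: "{1..2::nat} = insert 2 {1}" "{1..<2::nat} = {1}" "\<alpha> 1 = a" "\<alpha> 2 = b" "\<alpha> (Suc 0) = a"
    by (auto simp: \<alpha>_def)
  have [measurable]: "(\<lambda>y. k (y 1 / y 2)) \<in> borel_measurable (\<Pi>\<^sub>M i\<in>insert 2 {1::nat}. lborel)"
    by measurable
  have dens: "dirichlet_density 2 \<alpha> (simplex_point 2 x) = beta_density a b (x 1)" for x
    unfolding dirichlet_density_def beta_density_def simplex_point_def eqs
    using a b by (simp add: eqs Beta_def add.commute ac_simps)
  \<comment> \<open>The total \<open>s\<close> cancels from the quotient wherever its density is
    nonzero, and that density integrates to 1.\<close>
  have inner: "(\<integral>\<^sup>+s. ennreal (gamma_density (\<Sum>i=1..2. \<alpha> i) s) *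
      k ((\<lambda>i\<in>{1..2}. s * simplex_point 2 x i) 1 / (\<lambda>i\<in>{1..2}. s * simplex_point 2 x i) 2) \<partial>lborel) =
      k (x 1 / (1 - x 1))" for x
  proof -
    have "(\<integral>\<^sup>+s. ennreal (gamma_density (\<Sum>i=1..2. \<alpha> i) s) *
      k ((\<lambda>i\<in>{1..2}. s * simplex_point 2 x i) 1 / (\<lambda>i\<in>{1..2}. s * simplex_point 2 x i) 2) \<partial>lborel) =
        (\<integral>\<^sup>+s. ennreal (gamma_density (a + b) s) * k (x 1 / (1 - x 1)) \<partial>lborel)"
      by (intro nn_integral_cong) (auto simp: gamma_density_def simplex_point_def eqs add.commute)
    then show ?thesis
      using a b by (simp add: nn_integral_multc nn_integral_gamma_density)
  qed
  have "(\<integral>\<^sup>+y. k (y 1 / y 2) * (\<Prod>i=1..2. ennreal (gamma_density (\<alpha> i) (y i))) \<partial>(\<Pi>\<^sub>M i\<in>{1..2}. lborel)) =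
    (\<integral>\<^sup>+x. ennreal (dirichlet_density 2 \<alpha> (simplex_point 2 x)) *
       (\<integral>\<^sup>+s. ennreal (gamma_density (\<Sum>i=1..2. \<alpha> i) s) *
          k ((\<lambda>i\<in>{1..2}. s * simplex_point 2 x i) 1 / (\<lambda>i\<in>{1..2}. s * simplex_point 2 x i) 2) \<partial>lborel)
      \<partial>(\<Pi>\<^sub>M i\<in>{1..<2}. lborel))"
    using a b by (intro nn_integral_gamma_conv_dirichlet) (auto simp: \<alpha>_def)
  also have "\<dots> = (\<integral>\<^sup>+x. ennreal (beta_density a b (x 1)) * k (x 1 / (1 - x 1)) \<partial>(\<Pi>\<^sub>M i\<in>{1::nat}. lborel))"
    unfolding dens inner by (simp add: eqs(2))
  also have "\<dots> = (\<integral>\<^sup>+r. ennreal (beta_density a b r) * k (r / (1 - r)) \<partial>lborel)"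
    by (subst lborel_prod.product_nn_integral_singleton[where f = "\<lambda>r. ennreal (beta_density a b r) * k (r / (1 - r))"]) auto
  also have "\<dots> = (\<integral>\<^sup>+v. k v \<partial>beta_prime a b)"
    unfolding beta_prime_def by (subst nn_integral_distr) (auto simp: nn_integral_density)
  finally have "(\<integral>\<^sup>+v. k v \<partial>beta_prime a b) =
    (\<integral>\<^sup>+y. k (y 1 / y 2) * (ennreal (gamma_density b (y 2)) * ennreal (gamma_density a (y 1)))
      \<partial>(\<Pi>\<^sub>M i\<in>insert 2 {1::nat}. lborel))"
    by (simp add: eqs)
  \<comment> \<open>The denominator variable, coordinate 2, is integrated outermost.\<close>
  also have "\<dots> = (\<integral>\<^sup>+w. \<integral>\<^sup>+x. k (x 1 / w) * (ennreal (gamma_density b w) * ennreal (gamma_density a (x 1)))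
      \<partial>(\<Pi>\<^sub>M i\<in>{1::nat}. lborel) \<partial>lborel)"
    by (subst lborel_prod.product_nn_integral_insert_rev) auto
  also have "\<dots> = (\<integral>\<^sup>+w. \<integral>\<^sup>+s. k (s / w) * (ennreal (gamma_density b w) * ennreal (gamma_density a s))
      \<partial>lborel \<partial>lborel)"
    by (intro nn_integral_cong lborel_prod.product_nn_integral_singleton) measurable
  also have "\<dots> = (\<integral>\<^sup>+w. ennreal (gamma_density b w) * (\<integral>\<^sup>+s. ennreal (gamma_density a s) * k (s / w) \<partial>lborel) \<partial>lborel)"
    by (simp add: nn_integral_cmult[symmetric] ac_simps)
  finally show ?thesis .
qed

lemma prob_space_beta_prime:
  assumes "0 < a" "0 < b"
  shows "prob_space (beta_prime a b)"
proof
  show "emeasure (beta_prime a b) (space (beta_prime a b)) = 1"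
    using nn_integral_beta_prime[of a b "\<lambda>_. 1"] assms by (simp add: nn_integral_gamma_density)
qed

text \<open>In the quotient of Gamma variables the Dirichlet coordinate acts on the numerator alone,
  where it lowers the shape from the total concentration to \<open>\<alpha> l\<close>. It is applied
  once to the group proportions and once to those within a group.\<close>

lemma nn_integral_dirichlet_beta_prime:
  assumes pos: "\<And>i. i \<in> {1..n} \<Longrightarrow> 0 < \<alpha> i" and b: "0 < b" and l: "l \<in> {1..n}"
    and [measurable]: "k \<in> borel_measurable borel"
  shows "(\<integral>\<^sup>+\<phi>. (\<integral>\<^sup>+v. k (\<phi> l * v) \<partial>beta_prime (\<Sum>i=1..n. \<alpha> i) b) \<partial>dirichlet n \<alpha>) =
    (\<integral>\<^sup>+v. k v \<partial>beta_prime (\<alpha> l) b)"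
proof -
  let ?A = "\<Sum>i=1..n. \<alpha> i"
  have n: "1 \<le> n" using l by auto
  have A: "0 < ?A" using n pos by (intro sum_pos) auto
  interpret D: prob_space "dirichlet n \<alpha>" using n pos by (rule prob_space_dirichlet)
  interpret DL: pair_sigma_finite "dirichlet n \<alpha>" "lborel :: real measure" ..
  have [measurable]: "(\<lambda>\<phi>. \<phi> l) \<in> borel_measurable (dirichlet n \<alpha>)"
    using measurable_component_singleton[OF l, of "\<lambda>_. borel :: real measure"] by simp
  have "(\<integral>\<^sup>+\<phi>. (\<integral>\<^sup>+v. k (\<phi> l * v) \<partial>beta_prime ?A b) \<partial>dirichlet n \<alpha>) =
      (\<integral>\<^sup>+\<phi>. \<integral>\<^sup>+w. ennreal (gamma_density b w) *
        (\<integral>\<^sup>+s. ennreal (gamma_density ?A s) * k (\<phi> l * (s / w)) \<partial>lborel) \<partial>lborel \<partial>dirichlet n \<alpha>)"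
    using A b by (intro nn_integral_cong nn_integral_beta_prime) auto
  \<comment> \<open>The denominator \<open>w\<close> moves outside, so that the scaling identity
    applies for each fixed \<open>w\<close>.\<close>
  also have "\<dots> = (\<integral>\<^sup>+w. \<integral>\<^sup>+\<phi>. ennreal (gamma_density b w) *
        (\<integral>\<^sup>+s. ennreal (gamma_density ?A s) * k (\<phi> l * s / w) \<partial>lborel) \<partial>dirichlet n \<alpha> \<partial>lborel)"
    by (subst DL.Fubini') simp_all
  also have "\<dots> = (\<integral>\<^sup>+w. ennreal (gamma_density b w) * (\<integral>\<^sup>+\<phi>.
        (\<integral>\<^sup>+s. ennreal (gamma_density ?A s) * k (\<phi> l * s / w) \<partial>lborel) \<partial>dirichlet n \<alpha>) \<partial>lborel)"
    by (intro nn_integral_cong nn_integral_cmult) measurable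
  also have "\<dots> = (\<integral>\<^sup>+w. ennreal (gamma_density b w) *
        (\<integral>\<^sup>+s. ennreal (gamma_density (\<alpha> l) s) * k (s / w) \<partial>lborel) \<partial>lborel)"
    by (subst nn_integral_dirichlet_scaled[OF pos l, where k = "\<lambda>x. k (x / _)"]) auto
  also have "\<dots> = (\<integral>\<^sup>+v. k v \<partial>beta_prime (\<alpha> l) b)"
    using pos[OF l] b by (intro nn_integral_beta_prime[symmetric]) auto
  finally show ?thesis .
qed

section \<open>The law of the precision\<close>

lemma nn_integral_gamma_density_scale:
  assumes "0 < a" "0 < z"
  shows "(\<integral>\<^sup>+t. ennreal (gamma_density a (z * t)) \<partial>lborel) = ennreal (1 / z)"
proof -
  have "1 = ennreal z * (\<integral>\<^sup>+t. ennreal (gamma_density a (z * t)) \<partial>lborel)"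
    using nn_integral_real_affine[of "\<lambda>y. ennreal (gamma_density a y)" z 0] assms
    by (simp add: nn_integral_gamma_density)
  then have "ennreal (1 / z) * 1 = ennreal (1 / z) * (ennreal z * (\<integral>\<^sup>+t. ennreal (gamma_density a (z * t)) \<partial>lborel))"
    by simp
  then show ?thesis
    using assms by (simp add: mult.assoc[symmetric] ennreal_mult[symmetric])
qed

text \<open>The parameters appear in the order \<open>b a\<close> because this is the density of the
  reciprocal of a variable with law \<open>beta_prime a b\<close>.\<close>

definition beta_prime_density :: "real \<Rightarrow> real \<Rightarrow> real \<Rightarrow> real" where
  "beta_prime_density b a t = (if 0 < t then t powr (b - 1) * (1 + t) powr (- a - b) / Beta a b else 0)"

lemma beta_prime_density_measurable [measurable]: "beta_prime_density b a \<in> borel_measurable borel"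
  unfolding beta_prime_density_def by measurable

lemma Beta_real_pos: "0 < a \<Longrightarrow> 0 < b \<Longrightarrow> 0 < Beta a (b :: real)"
  by (simp add: Beta_def)

lemma beta_prime_density_nonneg: "0 < a \<Longrightarrow> 0 < b \<Longrightarrow> 0 \<le> beta_prime_density b a t"
  using Beta_real_pos[of a b] by (simp add: beta_prime_density_def)

text \<open>The joint density of the Gamma pair after substituting \<open>s * t\<close> for the
  denominator variable, with Jacobian \<open>s\<close>. The exponentials combine to
  \<open>exp (- ((1 + t) * s))\<close>; the last factor is grouped so that it is a probability
  density in \<open>s\<close>.\<close>

lemma gamma_density_ratio:
  assumes a: "0 < a" and b: "0 < b" and s: "0 < s" and t: "0 < t"
  shows "s * (gamma_density b (s * t) * gamma_density a s) =
    beta_prime_density b a t * ((1 + t) * gamma_density (a + b) ((1 + t) * s))"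
proof -
  have st: "0 < s * t" "0 < (1 + t) * s" using s t by (simp_all add: add_pos_pos)
  have Gamma_ab: "Gamma (a + b) \<noteq> 0"
    using Gamma_real_pos[of "a + b"] a b by linarith
  have s_powr: "s * s powr (b - 1) * s powr (a - 1) = s powr (a + b - 1)"
    using s powr_add[of s "b - 1" "a - 1"] powr_mult_base[of s "b - 1 + (a - 1)"]
    by (simp add: algebra_simps)
  \<comment> \<open>This factor 1 is inserted below to create the scaled Gamma density of shape
    \<open>a + b\<close>.\<close>
  have t_powr: "(1 + t) powr (- a - b) * (1 + t) * (1 + t) powr (a + b - 1) = 1"
    using t powr_add[of "1 + t" "- a - b" "a + b - 1"] powr_minus_divide[of "1 + t" 1]
    by (simp add: field_simps)
  have "s * (gamma_density b (s * t) * gamma_density a s) =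
      (s * s powr (b - 1) * s powr (a - 1)) * t powr (b - 1) * exp (- (s * t) - s) / (Gamma b * Gamma a)"
    using s t st by (simp add: gamma_density_def powr_mult exp_diff exp_minus field_simps)
  also have "\<dots> = ((1 + t) powr (- a - b) * (1 + t) * (1 + t) powr (a + b - 1)) *
      s powr (a + b - 1) * t powr (b - 1) * exp (- ((1 + t) * s)) / (Gamma b * Gamma a)"
    unfolding s_powr t_powr by (simp add: algebra_simps)
  also have "\<dots> = beta_prime_density b a t * ((1 + t) * gamma_density (a + b) ((1 + t) * s))"
    using s t st Gamma_ab
    by (simp add: gamma_density_def beta_prime_density_def powr_mult Beta_def mult_ac)
  finally show ?thesis .
qed

text \<open>For fixed \<open>s\<close> the substitution of \<open>s * t\<close> for \<open>w\<close>
  turns \<open>s / w\<close> into \<open>1 / t\<close>, after which \<open>s\<close> is integrated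
  out.\<close>

lemma nn_integral_beta_prime_inverse:
  assumes a: "0 < a" and b: "0 < b" and [measurable]: "k \<in> borel_measurable borel"
  shows "(\<integral>\<^sup>+v. k v \<partial>beta_prime a b) = (\<integral>\<^sup>+t. ennreal (beta_prime_density b a t) * k (1 / t) \<partial>lborel)"
proof -
  have "(\<integral>\<^sup>+v. k v \<partial>beta_prime a b) =
    (\<integral>\<^sup>+w. \<integral>\<^sup>+s. ennreal (gamma_density b w) * (ennreal (gamma_density a s) * k (s / w)) \<partial>lborel \<partial>lborel)"
    using a b by (simp add: nn_integral_beta_prime nn_integral_cmult)
  also have "\<dots> = (\<integral>\<^sup>+s. \<integral>\<^sup>+w. ennreal (gamma_density b w) * (ennreal (gamma_density a s) * k (s / w)) \<partial>lborel \<partial>lborel)"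
    by (rule lborel_pair.Fubini') measurable
  also have "\<dots> = (\<integral>\<^sup>+s. \<integral>\<^sup>+t. ennreal s * (ennreal (gamma_density b (s * t)) * (ennreal (gamma_density a s) * k (1 / t))) \<partial>lborel \<partial>lborel)"
  proof (rule nn_integral_cong)
    fix s :: real
    show "(\<integral>\<^sup>+w. ennreal (gamma_density b w) * (ennreal (gamma_density a s) * k (s / w)) \<partial>lborel) =
      (\<integral>\<^sup>+t. ennreal s * (ennreal (gamma_density b (s * t)) * (ennreal (gamma_density a s) * k (1 / t))) \<partial>lborel)"
    proof (cases "0 < s")
      case True
      then show ?thesis
        by (subst nn_integral_real_affine[where c = s and t = 0]) (simp_all add: nn_integral_cmult)
    next
      case False
      then show ?thesis by (simp add: gamma_density_def)
    qed
  qed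
  also have "\<dots> = (\<integral>\<^sup>+t. \<integral>\<^sup>+s. ennreal s * (ennreal (gamma_density b (s * t)) * (ennreal (gamma_density a s) * k (1 / t))) \<partial>lborel \<partial>lborel)"
    by (rule lborel_pair.Fubini') measurable
  also have "\<dots> = (\<integral>\<^sup>+t. ennreal (beta_prime_density b a t) * k (1 / t) \<partial>lborel)"
  proof (rule nn_integral_cong)
    fix t :: real
    show "(\<integral>\<^sup>+s. ennreal s * (ennreal (gamma_density b (s * t)) * (ennreal (gamma_density a s) * k (1 / t))) \<partial>lborel) =
      ennreal (beta_prime_density b a t) * k (1 / t)"
    proof (cases "0 < t")
      case True
      have "ennreal s * (ennreal (gamma_density b (s * t)) * (ennreal (gamma_density a s) * k (1 / t))) =
          ennreal (beta_prime_density b a t) * k (1 / t) * ennreal (1 + t) * ennreal (gamma_density (a + b) ((1 + t) * s))" for s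
      proof (cases "0 < s")
        case s: True
        have "ennreal s * (ennreal (gamma_density b (s * t)) * ennreal (gamma_density a s)) =
            ennreal (s * (gamma_density b (s * t) * gamma_density a s))"
          using s a b by (simp add: ennreal_mult gamma_density_nonneg)
        also have "\<dots> = ennreal (beta_prime_density b a t) *
            (ennreal (1 + t) * ennreal (gamma_density (a + b) ((1 + t) * s)))"
          using s True a b by (simp add: gamma_density_ratio ennreal_mult gamma_density_nonneg beta_prime_density_nonneg del: ennreal_plus)
        finally have eq: "ennreal s * (ennreal (gamma_density b (s * t)) * ennreal (gamma_density a s)) = \<dots>" .
        have "ennreal s * (ennreal (gamma_density b (s * t)) * (ennreal (gamma_density a s) * k (1 / t))) =
            ennreal s * (ennreal (gamma_density b (s * t)) * ennreal (gamma_density a s)) * k (1 / t)"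
          by (simp add: mult.assoc)
        then show ?thesis
          unfolding eq by (simp add: mult_ac del: ennreal_plus)
      next
        case False
        then have "\<not> 0 < (1 + t) * s" using True by (simp add: zero_less_mult_iff)
        then show ?thesis using False by (simp add: gamma_density_def ennreal_neg)
      qed
      then have "(\<integral>\<^sup>+s. ennreal s * (ennreal (gamma_density b (s * t)) * (ennreal (gamma_density a s) * k (1 / t))) \<partial>lborel) =
          ennreal (beta_prime_density b a t) * k (1 / t) * (ennreal (1 + t) * ennreal (1 / (1 + t)))"
        using True a b nn_integral_gamma_density_scale[of "a + b" "1 + t"]
        by (simp add: nn_integral_cmult mult.assoc del: ennreal_plus)
      also have "ennreal (1 + t) * ennreal (1 / (1 + t)) = 1"
        using True by (simp add: ennreal_mult[symmetric] del: ennreal_plus)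
      finally show ?thesis by simp
    next
      case False
      \<comment> \<open>For \<open>s\<close> > 0 the argument \<open>s * t\<close> is nonpositive;
        otherwise \<open>ennreal s\<close> truncates to 0.\<close>
      then have zero: "ennreal s * (ennreal (gamma_density b (s * t)) * x) = 0" for s x
        by (cases "0 < s") (auto simp: gamma_density_def zero_less_mult_iff ennreal_neg)
      show ?thesis
        unfolding zero using False by (simp add: beta_prime_density_def)
    qed
  qed
  finally show ?thesis .
qed

section \<open>The integral representation of \<open>hyperU\<close>\<close>

text \<open>\<open>hyperU\<close> is a Bochner integral, which defaults to 0 without integrability,
  so finiteness has to be shown. The bound on \<nu> makes the power of \<open>1 + t\<close> at most
  1 and leaves a multiple of a scaled Gamma density as majorant.\<close>

lemma nn_integral_hyperU:
  assumes \<eta>: "0 < \<eta>" and \<nu>: "\<nu> \<le> \<eta> + 1" and z: "0 < z"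
  shows "(\<integral>\<^sup>+t. ennreal (indicator {0<..} t * (exp (- z * t) * t powr (\<eta> - 1) * (1 + t) powr (\<nu> - \<eta> - 1))) \<partial>lborel) =
    ennreal (Gamma \<eta> * hyperU \<eta> \<nu> z)"
proof -
  let ?f = "\<lambda>t. indicator {0<..} t * (exp (- z * t) * t powr (\<eta> - 1) * (1 + t) powr (\<nu> - \<eta> - 1)) :: real"
  have G: "Gamma \<eta> \<noteq> 0"
    using Gamma_real_pos[OF \<eta>] by linarith
  have bound: "?f t \<le> Gamma \<eta> * z powr (1 - \<eta>) * gamma_density \<eta> (z * t)" for t
  proof (cases "0 < t")
    case True
    have "(1 + t) powr (\<nu> - \<eta> - 1) \<le> 1"
      using True \<nu> powr_mono[of "\<nu> - \<eta> - 1" 0 "1 + t"] by simp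
    then have "?f t \<le> exp (- z * t) * t powr (\<eta> - 1)"
      using True by (simp add: mult_left_le)
    also have "\<dots> = Gamma \<eta> * z powr (1 - \<eta>) * gamma_density \<eta> (z * t)"
      using True z G powr_add[of z "1 - \<eta>" "\<eta> - 1"]
      by (simp add: gamma_density_def powr_mult)
    finally show ?thesis .
  next
    case False
    then show ?thesis using \<eta> z by (auto intro!: mult_nonneg_nonneg gamma_density_nonneg less_imp_le[OF Gamma_real_pos])
  qed
  have "(\<integral>\<^sup>+t. ennreal (?f t) \<partial>lborel) \<le>
      (\<integral>\<^sup>+t. ennreal (Gamma \<eta> * z powr (1 - \<eta>) * gamma_density \<eta> (z * t)) \<partial>lborel)"
    by (intro nn_integral_mono ennreal_leI bound)
  also have "\<dots> = (\<integral>\<^sup>+t. ennreal (Gamma \<eta> * z powr (1 - \<eta>)) * ennreal (gamma_density \<eta> (z * t)) \<partial>lborel)"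
    using \<eta> less_imp_le[OF Gamma_real_pos[OF \<eta>]]
    by (intro nn_integral_cong ennreal_mult mult_nonneg_nonneg gamma_density_nonneg) auto
  also have "\<dots> < \<infinity>"
    using \<eta> z by (simp add: nn_integral_cmult nn_integral_gamma_density_scale ennreal_mult_less_top)
  finally have fin: "(\<integral>\<^sup>+t. ennreal (?f t) \<partial>lborel) < \<infinity>" .
  have nonneg: "0 \<le> ?f t" for t by simp
  have "integrable lborel ?f"
    using fin by (intro integrableI_nonneg) (auto simp: nonneg)
  then have "(\<integral>\<^sup>+t. ennreal (?f t) \<partial>lborel) = ennreal (\<integral>t. ?f t \<partial>lborel)"
    by (intro nn_integral_eq_integral) (auto simp: nonneg)
  also have "(\<integral>t. ?f t \<partial>lborel) = Gamma \<eta> * hyperU \<eta> \<nu> z"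
    using G by (simp add: hyperU_def set_lebesgue_integral_def)
  finally show ?thesis .
qed

lemma hyperU_measurable [measurable]: "hyperU \<eta> \<nu> \<in> borel_measurable borel"
  unfolding hyperU_def set_lebesgue_integral_def by measurable

section \<open>Normal laws with random variance\<close>

lemma sets_normal_var [simp, measurable_cong]: "sets (normal_var m v) = sets borel"
  by (simp add: normal_var_def)

lemma prob_space_normal_var: "prob_space (normal_var m v)"
  unfolding normal_var_def by (auto intro!: prob_space_normal_density prob_space_return)

lemma emeasure_normal_var:
  assumes [measurable]: "A \<in> sets borel"
  shows "emeasure (normal_var m v) A =
    (if 0 < v then \<integral>\<^sup>+x. ennreal (normal_density m (sqrt v) x) * indicator A x \<partial>lborel else indicator A m)"
  by (simp add: normal_var_def emeasure_density)

lemma normal_density_measurable2 [measurable (raw)]: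
  assumes [measurable]: "f \<in> borel_measurable M" "g \<in> borel_measurable M" "h \<in> borel_measurable M"
  shows "(\<lambda>x. normal_density (f x) (g x) (h x)) \<in> borel_measurable M"
  unfolding normal_density_def by measurable

text \<open>Makes the normal law a probability kernel in its variance, as needed for the product
  kernel and the \<open>bind\<close> of the prior.\<close>

lemma measurable_normal_var [measurable]: "normal_var m \<in> borel \<rightarrow>\<^sub>M prob_algebra borel"
proof (rule measurable_prob_algebraI)
  show "normal_var m \<in> borel \<rightarrow>\<^sub>M subprob_algebra borel"
  proof (rule measurable_subprob_algebra)
    fix A :: "real set" assume [measurable]: "A \<in> sets borel"
    show "(\<lambda>v. emeasure (normal_var m v) A) \<in> borel_measurable borel"
      by (subst emeasure_normal_var) measurable
  qed (auto intro: prob_space_imp_subprob_space prob_space_normal_var)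
qed (rule prob_space_normal_var)

text \<open>The precision \<open>t = 1 / v\<close> turns the mixture of normals into the integral defining \<^const>\<open>hyperU\<close>.\<close>

lemma nn_integral_normal_var_beta_prime:
  assumes a: "0 < a" and b: "0 < b" and [measurable]: "A \<in> sets borel"
  shows "(\<integral>\<^sup>+v. emeasure (normal_var 0 v) A \<partial>beta_prime a b) =
    (\<integral>\<^sup>+x. ennreal (1 / (sqrt (2 * pi) * Beta a b) * Gamma (b + 1 / 2) *
        hyperU (b + 1 / 2) (3 / 2 - a) (\<bar>x\<bar>\<^sup>2 / 2)) * indicator A x \<partial>lborel)"
proof -
  let ?C = "1 / (sqrt (2 * pi) * Beta a b)"
  have C: "0 < ?C" using Beta_real_pos[OF a b] by simp
  let ?f = "\<lambda>x t. indicator {0<..} t * (exp (- (\<bar>x\<bar>\<^sup>2 / 2) * t) * t powr (b + 1 / 2 - 1) *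
      (1 + t) powr (3 / 2 - a - (b + 1 / 2) - 1)) :: real"
  have [measurable]: "(\<lambda>v. emeasure (normal_var 0 v) A) \<in> borel_measurable borel"
    by (subst emeasure_normal_var) measurable
  \<comment> \<open>The normal density contributes \<open>sqrt t\<close>, raising the exponent
    \<open>b - 1\<close> to \<eta> - 1 with \<eta> = \<open>b + 1 / 2\<close>; the exponent
    \<open>- a - b\<close> equals \<nu> - \<eta> - 1 for \<nu> = \<open>3 / 2 - a\<close>.\<close>
  have dens: "beta_prime_density b a t * normal_density 0 (sqrt (1 / t)) x = ?C * ?f x t" if "0 < t" for t x
  proof -
    have t_powr: "t powr (b - 1) * sqrt t = t powr (b + 1 / 2 - 1)"
      using that by (simp add: powr_half_sqrt[symmetric] powr_add[symmetric] algebra_simps)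
    have normal: "normal_density 0 (sqrt (1 / t)) x = sqrt t / sqrt (2 * pi) * exp (- (\<bar>x\<bar>\<^sup>2 / 2) * t)"
      using that by (simp add: normal_density_def real_sqrt_divide real_sqrt_mult field_simps)
    have exponent: "3 / 2 - a - (b + 1 / 2) - 1 = - a - b" by simp
    show ?thesis
      unfolding normal exponent t_powr[symmetric] using that by (simp add: beta_prime_density_def mult_ac)
  qed
  have "(\<integral>\<^sup>+v. emeasure (normal_var 0 v) A \<partial>beta_prime a b) =
      (\<integral>\<^sup>+t. ennreal (beta_prime_density b a t) * emeasure (normal_var 0 (1 / t)) A \<partial>lborel)"
    using a b by (rule nn_integral_beta_prime_inverse) measurable
  also have "\<dots> = (\<integral>\<^sup>+t. \<integral>\<^sup>+x. ennreal (?C * ?f x t) * indicator A x \<partial>lborel \<partial>lborel)"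
  proof (rule nn_integral_cong)
    fix t :: real
    show "ennreal (beta_prime_density b a t) * emeasure (normal_var 0 (1 / t)) A =
      (\<integral>\<^sup>+x. ennreal (?C * ?f x t) * indicator A x \<partial>lborel)"
    proof (cases "0 < t")
      case True
      have "ennreal (beta_prime_density b a t) * emeasure (normal_var 0 (1 / t)) A =
         (\<integral>\<^sup>+x. ennreal (beta_prime_density b a t) *
            (ennreal (normal_density 0 (sqrt (1 / t)) x) * indicator A x) \<partial>lborel)"
        using True by (simp add: emeasure_normal_var nn_integral_cmult)
      also have "\<dots> = (\<integral>\<^sup>+x. ennreal (?C * ?f x t) * indicator A x \<partial>lborel)"
        using True a b unfolding dens[OF True, symmetric]
        by (intro nn_integral_cong) (simp add: ennreal_mult beta_prime_density_nonneg mult.assoc)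
      finally show ?thesis .
    qed (simp add: beta_prime_density_def)
  qed
  also have "\<dots> = (\<integral>\<^sup>+x. \<integral>\<^sup>+t. ennreal (?C * ?f x t) * indicator A x \<partial>lborel \<partial>lborel)"
    by (rule lborel_pair.Fubini') measurable
  also have "\<dots> = (\<integral>\<^sup>+x. ennreal (?C * Gamma (b + 1 / 2) *
        hyperU (b + 1 / 2) (3 / 2 - a) (\<bar>x\<bar>\<^sup>2 / 2)) * indicator A x \<partial>lborel)"
  proof (rule nn_integral_cong_AE)
    show "AE x in lborel. (\<integral>\<^sup>+t. ennreal (?C * ?f x t) * indicator A x \<partial>lborel) =
      ennreal (?C * Gamma (b + 1 / 2) * hyperU (b + 1 / 2) (3 / 2 - a) (\<bar>x\<bar>\<^sup>2 / 2)) * indicator A x"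
      \<comment> \<open>At \<open>x = 0\<close> the argument of \<open>hyperU\<close> is 0, where
        the integral diverges if \<open>a\<close> \<le> 1/2; this single point is a null
        set.\<close>
      using AE_lborel_singleton[of 0]
    proof eventually_elim
      fix x :: real assume x: "x \<noteq> 0"
      have "(\<integral>\<^sup>+t. ennreal (?C * ?f x t) * indicator A x \<partial>lborel) =
          (\<integral>\<^sup>+t. ennreal ?C * ennreal (?f x t) \<partial>lborel) * indicator A x"
        using C by (subst nn_integral_multc) (auto simp: ennreal_mult simp del: times_divide_eq_left)
      also have "\<dots> = ennreal ?C * ennreal (Gamma (b + 1 / 2) * hyperU (b + 1 / 2) (3 / 2 - a) (\<bar>x\<bar>\<^sup>2 / 2)) * indicator A x"
        using a b x by (subst nn_integral_cmult, measurable, subst nn_integral_hyperU) auto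
      also have "\<dots> = ennreal (?C * Gamma (b + 1 / 2) * hyperU (b + 1 / 2) (3 / 2 - a) (\<bar>x\<bar>\<^sup>2 / 2)) * indicator A x"
        using C by (simp add: ennreal_mult'[symmetric] mult.assoc)
      finally show "(\<integral>\<^sup>+t. ennreal (?C * ?f x t) * indicator A x \<partial>lborel) = \<dots>" .
    qed
  qed
  finally show ?thesis .
qed

section \<open>Marginals of the hierarchical prior\<close>

text \<open>It suffices to test the intersection-stable generator of measurable boxes, on which the
  product measure is a finite product of evaluations of the kernels.\<close>

lemma measurable_PiM_prob_algebra:
  assumes I: "finite I" and K: "\<And>i. i \<in> I \<Longrightarrow> K i \<in> M \<rightarrow>\<^sub>M prob_algebra (N i)"
  shows "(\<lambda>x. \<Pi>\<^sub>M i\<in>I. K i x) \<in> M \<rightarrow>\<^sub>M prob_algebra (\<Pi>\<^sub>M i\<in>I. N i)"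
proof (rule measurable_prob_algebra_generated[OF sets_PiM Int_stable_prod_algebra prod_algebra_sets_into_space])
  fix x assume x: "x \<in> space M"
  have Kx: "prob_space (K i x)" "sets (K i x) = sets (N i)" if "i \<in> I" for i
    using measurable_space[OF K[OF that] x] by (auto simp: space_prob_algebra)
  then show "prob_space (\<Pi>\<^sub>M i\<in>I. K i x)" "sets (\<Pi>\<^sub>M i\<in>I. K i x) = sets (\<Pi>\<^sub>M i\<in>I. N i)"
    by (auto intro!: prob_space_PiM sets_PiM_cong)
next
  fix A assume "A \<in> prod_algebra I N"
  then obtain E where A: "A = Pi\<^sub>E I E" and E: "E \<in> (\<Pi> i\<in>I. sets (N i))"
    by (rule prod_algebraE_all)
  have "emeasure (\<Pi>\<^sub>M i\<in>I. K i x) A = (\<Prod>i\<in>I. emeasure (K i x) (E i))" if x: "x \<in> space M" for x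
  proof -
    have Kx: "prob_space (K i x)" "sets (K i x) = sets (N i)" if "i \<in> I" for i
      using measurable_space[OF K[OF that] x] by (auto simp: space_prob_algebra)
    have E': "E i \<in> sets (K i x)" if "i \<in> I" for i
      using E Kx(2) that by auto
    then have "A = prod_emb I (\<lambda>i. K i x) I (Pi\<^sub>E I E)"
      unfolding A by (intro prod_emb_PiE_same_index[symmetric] sets.sets_into_space)
    then show ?thesis
      using I Kx E' by (simp add: emeasure_PiM_emb)
  qed
  moreover have "(\<lambda>x. \<Prod>i\<in>I. emeasure (K i x) (E i)) \<in> borel_measurable M"
    using K E by (intro borel_measurable_prod_ennreal measurable_emeasure_kernel measurable_prob_algebraD) auto
  ultimately show "(\<lambda>x. emeasure (\<Pi>\<^sub>M i\<in>I. K i x) A) \<in> borel_measurable M"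
    by (simp cong: measurable_cong)
qed

text \<open>Two successive reductions of the first beta prime parameter: the group proportion takes
  it from \<open>real G * a\<^sub>G\<close> to \<open>a\<^sub>G\<close>, and the within-group
  proportion from there to \<open>c g\<close>. The assumption \<open>cg\<close> makes the second
  start where the first ends.\<close>

lemma nn_integral_group_R2_hyper:
  assumes sizes: "\<forall>h\<in>{1..G}. 1 \<le> p h" and a\<^sub>G: "0 < a\<^sub>G" and a2: "0 < a\<^sub>2" and c: "\<forall>h\<in>{1..G}. 0 < c h"
    and cg: "real (p g) * c g = a\<^sub>G" and g: "g \<in> {1..G}" and l: "l \<in> {1..p g}"
    and k [measurable]: "k \<in> borel_measurable borel"
  shows "(\<integral>\<^sup>+(\<tau>2, \<phi>, \<psi>). k (\<psi> g l * \<phi> g * \<tau>2) \<partial>group_R2_hyper G p a\<^sub>G a\<^sub>2 c) =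
    (\<integral>\<^sup>+v. k v \<partial>beta_prime (c g) a\<^sub>2)"
proof -
  let ?T = "beta_prime (real G * a\<^sub>G) a\<^sub>2"
  let ?D = "dirichlet G (\<lambda>_. a\<^sub>G)"
  let ?W = "\<lambda>h. dirichlet (p h) (\<lambda>_. c h)"
  let ?P = "\<Pi>\<^sub>M h\<in>{1..G}. ?W h"
  have G: "1 \<le> G" using g by auto
  have W: "prob_space (?W h)" if "h \<in> {1..G}" for h
    using that sizes c by (intro prob_space_dirichlet) auto
  interpret T: prob_space ?T using G a\<^sub>G a2 by (intro prob_space_beta_prime) auto
  interpret B: prob_space "beta_prime a\<^sub>G a\<^sub>2" using a\<^sub>G a2 by (rule prob_space_beta_prime)
  interpret D: prob_space ?D using G a\<^sub>G by (intro prob_space_dirichlet)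
  interpret P: prob_space ?P using W by (rule prob_space_PiM)
  interpret DP: pair_prob_space ?D ?P ..
  interpret TDP: pair_prob_space ?T "?D \<Otimes>\<^sub>M ?P" ..
  have [measurable]: "(\<lambda>\<phi>. \<phi> g) \<in> borel_measurable ?D"
    using measurable_component_singleton[OF g, of "\<lambda>_. borel :: real measure"]
    by (simp cong: measurable_cong_sets)
  have [measurable]: "(\<lambda>y. y l) \<in> borel_measurable (?W g)"
    using measurable_component_singleton[OF l, of "\<lambda>_. borel :: real measure"]
    by (simp cong: measurable_cong_sets)
  have [measurable]: "(\<lambda>\<psi>. \<psi> g) \<in> ?P \<rightarrow>\<^sub>M ?W g"
    using g by (rule measurable_component_singleton)
  have [measurable]: "(\<lambda>\<psi>. \<psi> g l) \<in> borel_measurable ?P"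
    by (rule measurable_compose[where f = "\<lambda>\<psi>. \<psi> g" and g = "\<lambda>y. y l"]) measurable
  have "(\<integral>\<^sup>+(\<tau>2, \<phi>, \<psi>). k (\<psi> g l * \<phi> g * \<tau>2) \<partial>group_R2_hyper G p a\<^sub>G a\<^sub>2 c) =
      (\<integral>\<^sup>+q. \<integral>\<^sup>+\<tau>2. k (snd q g l * fst q g * \<tau>2) \<partial>?T \<partial>(?D \<Otimes>\<^sub>M ?P))"
    unfolding group_R2_hyper_def beta_prime_def[symmetric] case_prod_beta
    by (subst TDP.nn_integral_snd[symmetric]) auto
  also have "\<dots> = (\<integral>\<^sup>+\<psi>. \<integral>\<^sup>+\<phi>. \<integral>\<^sup>+\<tau>2. k (\<psi> g l * (\<phi> g * \<tau>2)) \<partial>?T \<partial>?D \<partial>?P)"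
    by (subst DP.nn_integral_snd[symmetric]) (auto simp: mult.assoc)
  also have "\<dots> = (\<integral>\<^sup>+\<psi>. \<integral>\<^sup>+\<tau>2. k (\<psi> g l * \<tau>2) \<partial>beta_prime a\<^sub>G a\<^sub>2 \<partial>?P)"
  proof (rule nn_integral_cong)
    fix \<psi> :: "nat \<Rightarrow> nat \<Rightarrow> real"
    show "(\<integral>\<^sup>+\<phi>. \<integral>\<^sup>+\<tau>2. k (\<psi> g l * (\<phi> g * \<tau>2)) \<partial>?T \<partial>?D) = (\<integral>\<^sup>+\<tau>2. k (\<psi> g l * \<tau>2) \<partial>beta_prime a\<^sub>G a\<^sub>2)"
      using nn_integral_dirichlet_beta_prime[of G "\<lambda>_. a\<^sub>G" a\<^sub>2 g "\<lambda>v. k (\<psi> g l * v)"] a\<^sub>G a2 g by simp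
  qed
  \<comment> \<open>The integrand sees only component \<open>g\<close> of the product, so the
    proportions of the other groups are marginalised out.\<close>
  also have "\<dots> = (\<integral>\<^sup>+y. \<integral>\<^sup>+\<tau>2. k (y l * \<tau>2) \<partial>beta_prime a\<^sub>G a\<^sub>2 \<partial>distr ?P (?W g) (\<lambda>\<psi>. \<psi> g))"
    by (subst nn_integral_distr) auto
  also have "distr ?P (?W g) (\<lambda>\<psi>. \<psi> g) = ?W g"
    using W g by (rule distr_PiM_component)
  also have "(\<integral>\<^sup>+y. \<integral>\<^sup>+\<tau>2. k (y l * \<tau>2) \<partial>beta_prime a\<^sub>G a\<^sub>2 \<partial>?W g) = (\<integral>\<^sup>+v. k v \<partial>beta_prime (c g) a\<^sub>2)"
    using nn_integral_dirichlet_beta_prime[of "p g" "\<lambda>_. c g" a\<^sub>2 l k] c g l a2 cg by simp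
  finally show ?thesis .
qed

text \<open>Projection commutes with \<open>bind\<close>, and projecting the conditional product of
  normals leaves the one normal factor at \<open>(g, l)\<close>. The marginal is therefore a mixture
  over the random variance.\<close>

lemma distr_group_R2_prior:
  assumes sizes: "\<forall>h\<in>{1..G}. 1 \<le> p h" and a\<^sub>G: "0 < a\<^sub>G" and a2: "0 < a\<^sub>2" and c: "\<forall>h\<in>{1..G}. 0 < c h"
    and g: "g \<in> {1..G}" and l: "l \<in> {1..p g}"
  shows "(\<lambda>b. b (g, l)) \<in> group_R2_prior G p a\<^sub>G a\<^sub>2 c \<rightarrow>\<^sub>M lborel"
    and "A \<in> sets borel \<Longrightarrow> emeasure (distr (group_R2_prior G p a\<^sub>G a\<^sub>2 c) lborel (\<lambda>b. b (g, l))) A =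
      (\<integral>\<^sup>+(\<tau>2, \<phi>, \<psi>). emeasure (normal_var 0 (\<psi> g l * \<phi> g * \<tau>2)) A \<partial>group_R2_hyper G p a\<^sub>G a\<^sub>2 c)"
proof -
  let ?H = "group_R2_hyper G p a\<^sub>G a\<^sub>2 c"
  let ?I = "SIGMA h:{1..G}. {1..p h}"
  let ?v = "\<lambda>i (\<tau>2, \<phi>, \<psi>). \<psi> (fst i) (snd i) * \<phi> (fst i) * \<tau>2 :: real"
  let ?K = "\<lambda>x. \<Pi>\<^sub>M i\<in>?I. normal_var 0 (?v i x)"
  let ?R = "\<Pi>\<^sub>M i\<in>?I. borel :: real measure"
  have prior: "group_R2_prior G p a\<^sub>G a\<^sub>2 c = ?H \<bind> ?K"
    unfolding group_R2_prior_def case_prod_beta' ..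
  have v [measurable]: "?v i \<in> borel_measurable ?H" if "i \<in> ?I" for i
  proof -
    have i: "fst i \<in> {1..G}" "snd i \<in> {1..p (fst i)}" using that by auto
    have [measurable]: "(\<lambda>\<phi>. \<phi> (fst i)) \<in> borel_measurable (dirichlet G (\<lambda>_. a\<^sub>G))"
      using measurable_component_singleton[OF i(1), of "\<lambda>_. borel :: real measure"]
      by (simp cong: measurable_cong_sets)
    have "(\<lambda>y. y (snd i)) \<in> borel_measurable (dirichlet (p (fst i)) (\<lambda>_. c (fst i)))"
      using measurable_component_singleton[OF i(2), of "\<lambda>_. borel :: real measure"]
      by (simp cong: measurable_cong_sets)
    from measurable_compose[OF measurable_component_singleton[OF i(1), of "\<lambda>h. dirichlet (p h) (\<lambda>_. c h)"] this]
    have [measurable]: "(\<lambda>\<psi>. \<psi> (fst i) (snd i)) \<in>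
        borel_measurable (\<Pi>\<^sub>M h\<in>{1..G}. dirichlet (p h) (\<lambda>_. c h))" .
    show ?thesis
      unfolding group_R2_hyper_def beta_prime_def[symmetric] case_prod_beta by measurable
  qed
  have K: "?K \<in> ?H \<rightarrow>\<^sub>M prob_algebra ?R"
    by (intro measurable_PiM_prob_algebra measurable_compose[OF v measurable_normal_var]) auto
  have gl: "(g, l) \<in> ?I" using g l by auto
  have "1 \<le> G" using g by auto
  then have "prob_space ?H"
    unfolding group_R2_hyper_def beta_prime_def[symmetric]
    using sizes a\<^sub>G a2 c
    by (intro prob_space_pair prob_space_PiM prob_space_beta_prime prob_space_dirichlet) auto
  \<comment> \<open>\<open>bind\<close> over an empty space is only a default value, so its rules
    ask for a nonempty one.\<close>
  then have H: "space ?H \<noteq> {}" by (rule prob_space.not_empty)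
  have comp: "(\<lambda>b. b (g, l)) \<in> ?R \<rightarrow>\<^sub>M lborel"
    using measurable_component_singleton[OF gl, of "\<lambda>_. borel :: real measure"] by simp
  have "sets (?H \<bind> ?K) = sets ?R"
    using measurable_prob_algebraD[OF K] H by (rule sets_bind_measurable)
  then show meas: "(\<lambda>b. b (g, l)) \<in> group_R2_prior G p a\<^sub>G a\<^sub>2 c \<rightarrow>\<^sub>M lborel"
    unfolding prior using comp by (simp cong: measurable_cong_sets)
  assume A: "A \<in> sets borel"
  have "distr (group_R2_prior G p a\<^sub>G a\<^sub>2 c) lborel (\<lambda>b. b (g, l)) =
      ?H \<bind> (\<lambda>x. distr (?K x) lborel (\<lambda>b. b (g, l)))"
    unfolding prior using measurable_prob_algebraD[OF K] H comp by (rule distr_bind)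
  also have "(\<lambda>x. distr (?K x) lborel (\<lambda>b. b (g, l))) = (\<lambda>x. normal_var 0 (?v (g, l) x))"
  proof
    fix x
    \<comment> \<open>Replacing the target changes nothing, as only its sigma-algebra matters; it
      then matches the component rule.\<close>
    have "distr (?K x) lborel (\<lambda>b. b (g, l)) = distr (?K x) (normal_var 0 (?v (g, l) x)) (\<lambda>b. b (g, l))"
      by (rule distr_cong) auto
    also have "\<dots> = normal_var 0 (?v (g, l) x)"
      using gl by (intro distr_PiM_component prob_space_normal_var)
    finally show "distr (?K x) lborel (\<lambda>b. b (g, l)) = normal_var 0 (?v (g, l) x)" .
  qed
  also have "emeasure (?H \<bind> (\<lambda>x. normal_var 0 (?v (g, l) x))) A =
      (\<integral>\<^sup>+x. emeasure (normal_var 0 (?v (g, l) x)) A \<partial>?H)"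
    using H measurable_prob_algebraD[OF measurable_compose[OF v[OF gl] measurable_normal_var]] A
    by (rule emeasure_bind)
  finally show "emeasure (distr (group_R2_prior G p a\<^sub>G a\<^sub>2 c) lborel (\<lambda>b. b (g, l))) A =
      (\<integral>\<^sup>+(\<tau>2, \<phi>, \<psi>). emeasure (normal_var 0 (\<psi> g l * \<phi> g * \<tau>2)) A \<partial>?H)"
    by (simp add: case_prod_beta')
qed

theorem proposition4:
  fixes G g l :: nat and p :: "nat \<Rightarrow> nat" and a\<^sub>G a\<^sub>2 :: real and c :: "nat \<Rightarrow> real"
  assumes sizes: "\<forall>h\<in>{1..G}. 1 \<le> p h"
    and a2: "0 < a\<^sub>2"
    and concentrations:
      "(0 < a\<^sub>G \<and> (\<forall>h\<in>{1..G}. c h = a\<^sub>G / real (p h))) \<or>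
       ((\<forall>h\<in>{1..G}. 0 < c h) \<and> a\<^sub>G = 1 / real G * (\<Sum>h=1..G. real (p h) * c h)
          \<and> c g = a\<^sub>G / real (p g))"
    and g: "g \<in> {1..G}"
    and l: "l \<in> {1..p g}"
  shows "let \<eta> = a\<^sub>2 + 1 / 2; \<nu> = 3 / 2 - c g in
     distributed (group_R2_prior G p a\<^sub>G a\<^sub>2 c) lborel (\<lambda>b. b (g, l))
       (\<lambda>x. let z = \<bar>x\<bar>\<^sup>2 / 2 in
          ennreal (1 / (sqrt (2 * pi) * Beta (c g) a\<^sub>2) * Gamma \<eta> * hyperU \<eta> \<nu> z))"
proof -
  have p: "0 < real (p h)" if "h \<in> {1..G}" for h
    using sizes that by fastforce
  \<comment> \<open>Both alternatives meet here: the total concentration within group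
    \<open>g\<close> equals the concentration of its group proportion.\<close>
  have cg: "real (p g) * c g = a\<^sub>G"
    using concentrations p[OF g] g by auto
  have c: "\<forall>h\<in>{1..G}. 0 < c h"
    using concentrations p by auto
  \<comment> \<open>Recovered from \<open>cg\<close>, which also covers the alternative where
    \<open>a\<^sub>G\<close> is given as an average.\<close>
  have a\<^sub>G: "0 < a\<^sub>G"
    using cg c g p[OF g] by (metis mult_pos_pos)
  let ?d = "\<lambda>x. ennreal (1 / (sqrt (2 * pi) * Beta (c g) a\<^sub>2) * Gamma (a\<^sub>2 + 1 / 2) *
    hyperU (a\<^sub>2 + 1 / 2) (3 / 2 - c g) (\<bar>x\<bar>\<^sup>2 / 2))"
  have "distr (group_R2_prior G p a\<^sub>G a\<^sub>2 c) lborel (\<lambda>b. b (g, l)) = density lborel ?d"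
  proof (rule measure_eqI)
    fix A assume "A \<in> sets (distr (group_R2_prior G p a\<^sub>G a\<^sub>2 c) lborel (\<lambda>b. b (g, l)))"
    then have A [measurable]: "A \<in> sets borel" by simp
    have [measurable]: "(\<lambda>v. emeasure (normal_var 0 v) A) \<in> borel_measurable borel"
      by (subst emeasure_normal_var) measurable
    have "emeasure (distr (group_R2_prior G p a\<^sub>G a\<^sub>2 c) lborel (\<lambda>b. b (g, l))) A =
        (\<integral>\<^sup>+v. emeasure (normal_var 0 v) A \<partial>beta_prime (c g) a\<^sub>2)"
      unfolding distr_group_R2_prior(2)[OF sizes a\<^sub>G a2 c g l A]
      by (rule nn_integral_group_R2_hyper[OF sizes a\<^sub>G a2 c cg g l]) measurable
    also have "\<dots> = emeasure (density lborel ?d) A"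
      using c g a2 by (subst nn_integral_normal_var_beta_prime) (auto simp: emeasure_density)
    finally show "emeasure (distr (group_R2_prior G p a\<^sub>G a\<^sub>2 c) lborel (\<lambda>b. b (g, l))) A =
      emeasure (density lborel ?d) A" .
  qed simp
  then show ?thesis
    unfolding distributed_def Let_def
    using distr_group_R2_prior(1)[OF sizes a\<^sub>G a2 c g l] by simp
qed

end
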